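(* Let $(X,d,\mu)$ be a space of homogeneous type and $m\ge 1$ an integer. Let $p_i(\cdot)\in\mathscr P$, $i=1,\dots,m$, with $\frac1{p(\cdot)}=\sum_{i=1}^m\frac1{p_i(\cdot)}$, let $q(\cdot)\in\mathscr P_0$ and let $\eta\in[0,m)$ be a constant with $\frac1{p(\cdot)}-\frac1{q(\cdot)}=\eta$. Let $\vec\omega=(\omega_1,\dots,\omega_m,\omega)$ be a multiple weight. Then the operators $\mathscr A_{\eta,B}$ are bounded from $L^{p_1(\cdot)}(X,\omega_1)\times\cdots\times L^{p_m(\cdot)}(X,\omega_m)$ to $L^{q(\cdot)}(X,\omega)$ uniformly for all balls $B\subseteq X$ if and only if $\vec\omega\in A_{\vec p(\cdot),q(\cdot)}(X)$. Furthermore, $$[\vec\omega]_{A_{\vec p(\cdot),q(\cdot)}(X)}\le C\,\sup_{B}\|\mathscr A_{\eta,B}\|_{\prod_{i=1}^m L^{p_i(\cdot)}(X,\omega_i)\to L^{q(\cdot)}(X,\omega)}\quad\text{and}\quad \sup_{B}\|\mathscr A_{\eta,B}\|_{\prod_{i=1}^m L^{p_i(\cdot)}(X,\omega_i)\to L^{q(\cdot)}(X,\omega)}\le[\vec\omega]_{A_{\vec p(\cdot),q(\cdot)}(X)},$$ where the supremum is over all balls $B\subseteq X$ and the constant $C$ depends only on $\vec p(\cdot)=(p_1(\cdot),\dots,p_m(\cdot))$.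
   Context: Space of homogeneous type: a nonempty set $X$ with a quasi-metric $d:X\times X\to[0,\infty)$ (i.e. $d(x,y)=0$ when $x=y$, $d(x,y)=d(y,x)$, and $d(x,y)\le A_0(d(x,z)+d(z,y))$ for some constant $A_0\ge1$) and a regular measure $\mu$ on the $\sigma$-algebra generated by open sets and quasi-metric balls $B(x,r)$, which is doubling: $0<\mu(B(x,2r))\le C_\mu\,\mu(B(x,r))<\infty$ for all $x\in X$, $r>0$. Exponents: for measurable $p(\cdot)$ on $X$, $p_-=\operatorname{ess\,inf}_X p$, $p_+=\operatorname{ess\,sup}_X p$. $\mathscr P$ is the set of measurable $p(\cdot):X\to[1,\infty)$ with $1<p_-\le p_+<\infty$; $\mathscr P_0$ is the set of measurable $p(\cdot):X\to(0,\infty)$ with $0<p_-\le p_+<\infty$. The conjugate exponent is $p'(\cdot)=p(\cdot)/(p(\cdot)-1)$. Norms: for $p(\cdot)\in\mathscr P_0$, $\|f\|_{L^{p(\cdot)}}=\|f\|_{p(\cdot)}=\inf\{\lambda>0:\int_X|f(x)/\lambda|^{p(x)}d\mu\le1\}$, and $\|f\|_{L^{p(\cdot)}(X,\omega)}=\|\omega f\|_{p(\cdot)}$. Weights: a weight is a locally integrable $\omega:X\to[0,\infty]$ with $0<\omega<\infty$ a.e.; a multiple weight $\vec\omega=(\omega_1,\dots,\omega_m,\omega)$ is a tuple of weights. $\vec\omega\in A_{\vec p(\cdot),q(\cdot)}(X)$ means $$[\vec\omega]_{A_{\vec p(\cdot),q(\cdot)}(X)}:=\sup_{B\subseteq X}\mu(B)^{\eta-m}\|\omega\chi_B\|_{q(\cdot)}\prod_{i=1}^m\|\omega_i^{-1}\chi_B\|_{p_i'(\cdot)}<\infty,$$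 the supremum being over all balls $B$. Operator: for a ball $B$ and $\vec f=(f_1,\dots,f_m)$, $\mathscr A_{\eta,B}(\vec f)(x)=\mu(B)^\eta\Big(\prod_{i=1}^m\frac1{\mu(B)}\int_B|f_i|\,d\mu\Big)\chi_B(x)$. The operator norm is the least $C\ge 0$ (possibly $\infty$) with $\|\mathscr A_{\eta,B}(\vec f)\|_{L^{q(\cdot)}(X,\omega)}\le C\prod_i\|f_i\|_{L^{p_i(\cdot)}(X,\omega_i)}$.
   Formalization: The second inequality is proved as sup_B ‖A_{η,B}‖ ≤ C [ω], with C depending only on p_1(·),…,p_m(·); with constant 1, as stated, it fails for some non-constant exponents, e.g. on a two-point space with p = 2 and 3/2. *)

theory Defs
  imports "HOL-Probability.Essential_Supremum"
begin

section \<open>Spaces of homogeneous type\<close>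

text \<open>The space \<open>X\<close> is the (nonempty) type \<open>'a\<close>. Only \<open>d x x = 0\<close> is required; points
  at distance 0 need not coincide.\<close>

definition quasi_metric :: "('a \<Rightarrow> 'a \<Rightarrow> real) \<Rightarrow> bool" where
  "quasi_metric d \<longleftrightarrow>
     (\<forall>x y. 0 \<le> d x y) \<and> (\<forall>x. d x x = 0) \<and> (\<forall>x y. d x y = d y x) \<and>
     (\<exists>A0\<ge>1. \<forall>x y z. d x y \<le> A0 * (d x z + d z y))"

definition qball :: "('a \<Rightarrow> 'a \<Rightarrow> real) \<Rightarrow> 'a \<Rightarrow> real \<Rightarrow> 'a set" where
  "qball d x r = {y. d x y < r}"

definition qballs :: "('a \<Rightarrow> 'a \<Rightarrow> real) \<Rightarrow> 'a set set" where
  "qballs d = {qball d x r | x r. 0 < r}"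

text \<open>Quasi-metric balls need not be open in this topology, which is why they appear
  separately among the generators of the \<open>\<sigma>\<close>-algebra below.\<close>

definition qtopology :: "('a \<Rightarrow> 'a \<Rightarrow> real) \<Rightarrow> 'a topology" where
  "qtopology d = topology (\<lambda>U. \<forall>x\<in>U. \<exists>r>0. qball d x r \<subseteq> U)"

lemma openin_qtopology:
  "openin (qtopology d) U \<longleftrightarrow> (\<forall>x\<in>U. \<exists>r>0. qball d x r \<subseteq> U)"
proof -
  have "istopology (\<lambda>U. \<forall>x\<in>U. \<exists>r>0. qball d x r \<subseteq> U)"
    unfolding istopology_def
  proof (intro conjI allI impI ballI)
    fix S T x
    assume S: "\<forall>x\<in>S. \<exists>r>0. qball d x r \<subseteq> S" and T: "\<forall>x\<in>T. \<exists>r>0. qball d x r \<subseteq> T"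
      and x: "x \<in> S \<inter> T"
    then obtain r s where "r > 0" "qball d x r \<subseteq> S" "s > 0" "qball d x s \<subseteq> T"
      by blast
    then show "\<exists>r>0. qball d x r \<subseteq> S \<inter> T"
      by (intro exI[of _ "min r s"]) (auto simp: qball_def)
  next
    fix \<K> x
    assume "\<forall>K\<in>\<K>. \<forall>x\<in>K. \<exists>r>0. qball d x r \<subseteq> K" and "x \<in> \<Union>\<K>"
    then show "\<exists>r>0. qball d x r \<subseteq> \<Union>\<K>"
      by (meson Union_iff Union_upper order_trans)
  qed
  then show ?thesis
    by (simp add: qtopology_def topology_inverse')
qed

definition regular_measure :: "'a topology \<Rightarrow> 'a measure \<Rightarrow> bool" where
  "regular_measure T M \<longleftrightarrow>
     (\<forall>E\<in>sets M. emeasure M E = (INF U\<in>{U. openin T U \<and> E \<subseteq> U}. emeasure M U) \<and>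
                  emeasure M E = (SUP K\<in>{K. compactin T K \<and> K \<in> sets M \<and> K \<subseteq> E}. emeasure M K))"

definition doubling :: "('a \<Rightarrow> 'a \<Rightarrow> real) \<Rightarrow> 'a measure \<Rightarrow> bool" where
  "doubling d M \<longleftrightarrow>
     (\<exists>C::real. \<forall>x. \<forall>r>0.
        0 < emeasure M (qball d x (2 * r)) \<and>
        emeasure M (qball d x (2 * r)) \<le> ennreal C * emeasure M (qball d x r) \<and>
        emeasure M (qball d x r) < \<infinity>)"

definition homogeneous_type :: "('a \<Rightarrow> 'a \<Rightarrow> real) \<Rightarrow> 'a measure \<Rightarrow> bool" where
  "homogeneous_type d M \<longleftrightarrow>
     quasi_metric d \<and>
     space M = UNIV \<and>
     sets M = sigma_sets UNIV ({U. openin (qtopology d) U} \<union> qballs d) \<and>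
     regular_measure (qtopology d) M \<and>
     doubling d M"


section \<open>Variable exponents and Luxemburg norms\<close>

definition exp_minus :: "'a measure \<Rightarrow> ('a \<Rightarrow> real) \<Rightarrow> ereal" where
  "exp_minus M p = - esssup M (\<lambda>x. - ereal (p x))"

definition exp_plus :: "'a measure \<Rightarrow> ('a \<Rightarrow> real) \<Rightarrow> ereal" where
  "exp_plus M p = esssup M (\<lambda>x. ereal (p x))"

definition exponents :: "'a measure \<Rightarrow> ('a \<Rightarrow> real) set" where
  "exponents M = {p \<in> borel_measurable M. (\<forall>x. 1 \<le> p x) \<and>
     1 < exp_minus M p \<and> exp_minus M p \<le> exp_plus M p \<and> exp_plus M p < \<infinity>}"

definition exponents0 :: "'a measure \<Rightarrow> ('a \<Rightarrow> real) set" where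
  "exponents0 M = {p \<in> borel_measurable M. (\<forall>x. 0 < p x) \<and>
     0 < exp_minus M p \<and> exp_minus M p \<le> exp_plus M p \<and> exp_plus M p < \<infinity>}"

text \<open>For \<open>p \<in> exponents M\<close> the set where \<open>p x = 1\<close> (and where this is the junk value 0) is a
  null set, so it does not affect the norms below.\<close>

definition conj_exp :: "('a \<Rightarrow> real) \<Rightarrow> 'a \<Rightarrow> real" where
  "conj_exp p = (\<lambda>x. p x / (p x - 1))"

definition enn_powr :: "ennreal \<Rightarrow> real \<Rightarrow> ennreal" where
  "enn_powr t a = (if t = \<infinity> then \<infinity> else ennreal (enn2real t powr a))"

text \<open>The norm of \<open>f\<close> is the value at \<open>g = |f|\<close>; the infimum of the empty set is \<open>\<infinity>\<close>.\<close>

definition lux_norm :: "'a measure \<Rightarrow> ('a \<Rightarrow> real) \<Rightarrow> ('a \<Rightarrow> ennreal) \<Rightarrow> ennreal" where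
  "lux_norm M p g =
     Inf {ennreal l | l. 0 < l \<and> (\<integral>\<^sup>+x. enn_powr (g x / ennreal l) (p x) \<partial>M) \<le> 1}"

definition wnorm ::
  "'a measure \<Rightarrow> ('a \<Rightarrow> real) \<Rightarrow> ('a \<Rightarrow> ennreal) \<Rightarrow> ('a \<Rightarrow> ennreal) \<Rightarrow> ennreal" where
  "wnorm M p w g = lux_norm M p (\<lambda>x. w x * g x)"

definition wLp :: "'a measure \<Rightarrow> ('a \<Rightarrow> real) \<Rightarrow> ('a \<Rightarrow> ennreal) \<Rightarrow> ('a \<Rightarrow> real) set" where
  "wLp M p w = {f \<in> borel_measurable M. wnorm M p w (\<lambda>x. ennreal \<bar>f x\<bar>) < \<infinity>}"


section \<open>Weights\<close>

definition weight :: "('a \<Rightarrow> 'a \<Rightarrow> real) \<Rightarrow> 'a measure \<Rightarrow> ('a \<Rightarrow> ennreal) \<Rightarrow> bool" where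
  "weight d M w \<longleftrightarrow>
     w \<in> borel_measurable M \<and>
     (\<forall>B\<in>qballs d. (\<integral>\<^sup>+x\<in>B. w x \<partial>M) < \<infinity>) \<and>
     (AE x in M. 0 < w x \<and> w x < \<infinity>)"

definition multiple_weight ::
  "('a \<Rightarrow> 'a \<Rightarrow> real) \<Rightarrow> 'a measure \<Rightarrow> nat \<Rightarrow> (nat \<Rightarrow> 'a \<Rightarrow> ennreal) \<Rightarrow> ('a \<Rightarrow> ennreal) \<Rightarrow> bool" where
  "multiple_weight d M m ws w \<longleftrightarrow> (\<forall>i\<in>{1..m}. weight d M (ws i)) \<and> weight d M w"

definition A_const ::
  "('a \<Rightarrow> 'a \<Rightarrow> real) \<Rightarrow> 'a measure \<Rightarrow> nat \<Rightarrow> real \<Rightarrow> (nat \<Rightarrow> 'a \<Rightarrow> real) \<Rightarrow> ('a \<Rightarrow> real) \<Rightarrow>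
   (nat \<Rightarrow> 'a \<Rightarrow> ennreal) \<Rightarrow> ('a \<Rightarrow> ennreal) \<Rightarrow> ennreal" where
  "A_const d M m \<eta> ps q ws w =
     (SUP B\<in>qballs d.
        enn_powr (emeasure M B) (\<eta> - real m) *
        lux_norm M q (\<lambda>x. w x * indicator B x) *
        (\<Prod>i=1..m. lux_norm M (conj_exp (ps i)) (\<lambda>x. inverse (ws i x) * indicator B x)))"

definition A_class ::
  "('a \<Rightarrow> 'a \<Rightarrow> real) \<Rightarrow> 'a measure \<Rightarrow> nat \<Rightarrow> real \<Rightarrow> (nat \<Rightarrow> 'a \<Rightarrow> real) \<Rightarrow> ('a \<Rightarrow> real) \<Rightarrow>
   ((nat \<Rightarrow> 'a \<Rightarrow> ennreal) \<times> ('a \<Rightarrow> ennreal)) set" where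
  "A_class d M m \<eta> ps q =
     {(ws, w). multiple_weight d M m ws w \<and> A_const d M m \<eta> ps q ws w < \<infinity>}"


section \<open>The averaging operators\<close>

definition avg_op ::
  "'a measure \<Rightarrow> nat \<Rightarrow> real \<Rightarrow> 'a set \<Rightarrow> (nat \<Rightarrow> 'a \<Rightarrow> real) \<Rightarrow> 'a \<Rightarrow> ennreal" where
  "avg_op M m \<eta> B fs = (\<lambda>x.
     enn_powr (emeasure M B) \<eta> *
     (\<Prod>i=1..m. (\<integral>\<^sup>+y\<in>B. ennreal \<bar>fs i y\<bar> \<partial>M) / emeasure M B) * indicator B x)"

definition avg_op_bound ::
  "'a measure \<Rightarrow> nat \<Rightarrow> real \<Rightarrow> (nat \<Rightarrow> 'a \<Rightarrow> real) \<Rightarrow> ('a \<Rightarrow> real) \<Rightarrow>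
   (nat \<Rightarrow> 'a \<Rightarrow> ennreal) \<Rightarrow> ('a \<Rightarrow> ennreal) \<Rightarrow> 'a set \<Rightarrow> ennreal \<Rightarrow> bool" where
  "avg_op_bound M m \<eta> ps q ws w B K \<longleftrightarrow>
     (\<forall>fs. (\<forall>i\<in>{1..m}. fs i \<in> wLp M (ps i) (ws i)) \<longrightarrow>
        wnorm M q w (avg_op M m \<eta> B fs) \<le>
        K * (\<Prod>i=1..m. wnorm M (ps i) (ws i) (\<lambda>x. ennreal \<bar>fs i x\<bar>)))"

text \<open>The supremum of these norms over balls is comparable to, but in general not bounded by,
  \<open>A_const\<close>: for nonconstant \<open>p\<close> the inequality \<open>\<integral>|f g| \<le> K \<parallel>f\<parallel>\<^sub>p \<parallel>g\<parallel>\<^sub>p\<^sub>'\<close> between Luxemburg norms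
  may require \<open>K > 1\<close>.\<close>

definition avg_op_norm ::
  "'a measure \<Rightarrow> nat \<Rightarrow> real \<Rightarrow> (nat \<Rightarrow> 'a \<Rightarrow> real) \<Rightarrow> ('a \<Rightarrow> real) \<Rightarrow>
   (nat \<Rightarrow> 'a \<Rightarrow> ennreal) \<Rightarrow> ('a \<Rightarrow> ennreal) \<Rightarrow> 'a set \<Rightarrow> ennreal" where
  "avg_op_norm M m \<eta> ps q ws w B = Inf {K. avg_op_bound M m \<eta> ps q ws w B K}"

definition unif_bounded ::
  "('a \<Rightarrow> 'a \<Rightarrow> real) \<Rightarrow> 'a measure \<Rightarrow> nat \<Rightarrow> real \<Rightarrow> (nat \<Rightarrow> 'a \<Rightarrow> real) \<Rightarrow> ('a \<Rightarrow> real) \<Rightarrow>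
   (nat \<Rightarrow> 'a \<Rightarrow> ennreal) \<Rightarrow> ('a \<Rightarrow> ennreal) \<Rightarrow> bool" where
  "unif_bounded d M m \<eta> ps q ws w \<longleftrightarrow>
     (\<exists>K::real. \<forall>B\<in>qballs d. avg_op_bound M m \<eta> ps q ws w B (ennreal K))"

end

theory Submission
  imports Defs
begin

text \<open>
  Both inequalities are proved for each ball \<open>B\<close> separately. There the operator is a scalar times
  \<open>\<chi>\<^sub>B\<close>: with \<open>c = \<mu>(B)\<^sup>\<eta>\<^sup>-\<^sup>m \<Prod>\<^sub>i \<integral>\<^sub>B |f\<^sub>i|\<close> the norm of its value is \<open>c \<parallel>\<omega> \<chi>\<^sub>B\<parallel>\<^sub>q\<close>, so everything reduces to
  estimating the integrals \<open>\<integral>\<^sub>B |f\<^sub>i|\<close> by \<open>N\<^sub>i = \<parallel>\<omega>\<^sub>i\<^sup>-\<^sup>1 \<chi>\<^sub>B\<parallel>\<^sub>p\<^sub>'\<close>, the norm in the conjugate exponent of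
  \<open>p\<^sub>i\<close>, in both directions.

  From above, write \<open>|f\<^sub>i| = (\<omega>\<^sub>i |f\<^sub>i|) \<omega>\<^sub>i\<^sup>-\<^sup>1\<close>. The pointwise Young inequality gives a Hoelder inequality
  for Luxemburg norms with constant 2 (\<^emph>\<open>lux_norm_Holder_inequality\<close>), and so
  \<open>\<integral>\<^sub>B |f\<^sub>i| \<le> 2 \<parallel>\<omega>\<^sub>i f\<^sub>i\<parallel> N\<^sub>i\<close>. Multiplying these \<open>m\<close> bounds shows that the norm of the operator is at most
  \<open>2\<^sup>m\<close> times the term of the weight constant that belongs to \<open>B\<close>.

  From below, for every \<open>l < N\<^sub>i\<close> there is an \<open>f\<^sub>i\<close> with \<open>\<parallel>\<omega>\<^sub>i f\<^sub>i\<parallel> \<le> 1\<close> and \<open>\<integral>\<^sub>B |f\<^sub>i| \<ge> l\<close>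
  (\<^emph>\<open>lux_norm_conj_exp_norming\<close>). Testing the operator on these functions and letting each \<open>l\<close> increase
  to \<open>N\<^sub>i\<close> bounds the term of \<open>B\<close> by the operator norm, with constant 1. The theorem therefore holds with
  \<open>C = 2\<^sup>m\<close>.

  Any of the norms may be \<open>0\<close> or \<open>\<infinity>\<close>, and \<open>0 \<cdot> \<infinity> = 0\<close> in \<^typ>\<open>ennreal\<close>. The estimates survive this
  because a function of Luxemburg norm 0 vanishes almost everywhere
  (\<^emph>\<open>AE_zero_if_lux_norm_zero\<close>): a product that is formally \<open>0 \<cdot> \<infinity>\<close> then bounds something that is
  really zero.
\<close>

section \<open>Powers of extended nonnegative numbers\<close>

lemma enn_powr_zero [simp]: "enn_powr 0 a = 0"
  by (simp add: enn_powr_def)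

lemma enn_powr_ennreal [simp]: "0 \<le> s \<Longrightarrow> enn_powr (ennreal s) a = ennreal (s powr a)"
  by (simp add: enn_powr_def)

lemma enn_powr_top [simp]: "enn_powr top a = top"
  by (simp add: enn_powr_def)

lemma enn_powr_mono:
  assumes "s \<le> t" "0 \<le> a"
  shows "enn_powr s a \<le> enn_powr t a"
  using assms by (cases s; cases t) (auto simp: top_unique intro!: powr_mono2)

lemma borel_measurable_enn_powr [measurable]:
  assumes [measurable]: "g \<in> borel_measurable M" "p \<in> borel_measurable M"
  shows "(\<lambda>x. enn_powr (g x) (p x)) \<in> borel_measurable M"
  unfolding enn_powr_def by measurable

lemma enn_powr_Youngs_inequality:
  assumes "1 < p"
  shows "s * t \<le> enn_powr s p + enn_powr t (p / (p - 1))"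
proof (cases "s = top \<or> t = top")
  case False
  then obtain a b where a: "s = ennreal a" "0 \<le> a" and b: "t = ennreal b" "0 \<le> b"
    by (metis ennreal_cases)
  let ?q = "p / (p - 1)"
  have q: "1 < ?q" "1 / p + 1 / ?q = 1"
    using assms by (auto simp: field_simps)
  have le: "x / r \<le> x" if "1 < r" "0 \<le> x" for x r :: real
    using that by (simp add: divide_le_eq mult_le_cancel_left1)
  have "a * b \<le> a powr p / p + b powr ?q / ?q"
    using Youngs_inequality[OF assms q a(2) b(2)] .
  also have "\<dots> \<le> a powr p + b powr ?q"
    using assms q(1) by (intro add_mono le) auto
  finally show ?thesis
    by (simp add: a b flip: ennreal_mult ennreal_plus del: ennreal_plus)
qed auto

section \<open>Luxemburg norms\<close>

lemma mult_divide_cancel_ennreal: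
  fixes a c :: ennreal
  assumes "c \<noteq> 0" "c \<noteq> top"
  shows "c * (a / c) = a"
  using ennreal_mult_divide_eq[OF assms, of a] by (simp add: ennreal_times_divide mult.commute)

lemma mult_inverse_ennreal:
  fixes c :: ennreal
  assumes "0 < c" "c < top"
  shows "c * inverse c = 1"
  using mult_divide_cancel_ennreal[of c 1] assms by (simp add: divide_ennreal_def)

lemma le_cmult_Inf_ennreal:
  fixes c :: ennreal
  assumes "c \<noteq> 0" "c \<noteq> top" and le: "\<And>s. s \<in> S \<Longrightarrow> a \<le> c * s"
  shows "a \<le> c * Inf S"
proof -
  have "a / c \<le> Inf S"
    using assms by (intro Inf_greatest divide_le_posI_ennreal) (auto simp: zero_less_iff_neq_zero)
  then have "c * (a / c) \<le> c * Inf S"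
    by (rule mult_left_mono) simp
  also have "c * (a / c) = a"
    using assms(1,2) by (rule mult_divide_cancel_ennreal)
  finally show ?thesis .
qed

lemma lux_norm_le:
  assumes "0 < l" "(\<integral>\<^sup>+x. enn_powr (g x / ennreal l) (p x) \<partial>M) \<le> 1"
  shows "lux_norm M p g \<le> ennreal l"
  unfolding lux_norm_def using assms by (intro Inf_lower) auto

lemma lux_norm_mono:
  assumes "AE x in M. g x \<le> h x" "AE x in M. 0 \<le> p x"
  shows "lux_norm M p g \<le> lux_norm M p h"
  unfolding lux_norm_def[of M p h]
proof (intro Inf_greatest, safe)
  fix l :: real
  assume l: "0 < l" "(\<integral>\<^sup>+x. enn_powr (h x / ennreal l) (p x) \<partial>M) \<le> 1"
  have "(\<integral>\<^sup>+x. enn_powr (g x / ennreal l) (p x) \<partial>M) \<le> (\<integral>\<^sup>+x. enn_powr (h x / ennreal l) (p x) \<partial>M)"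
    using assms
    by (intro nn_integral_mono_AE) (auto intro!: enn_powr_mono divide_right_mono_ennreal)
  with l show "lux_norm M p g \<le> ennreal l"
    by (intro lux_norm_le) auto
qed

text \<open>A norm below \<open>l\<close> only provides some admissible \<open>k < l\<close>; since the modular
  \<open>\<integral> (g / k)\<^sup>p\<close> decreases in \<open>k\<close>, every larger number is admissible too.\<close>

lemma modular_le_1_if_lux_norm_less:
  assumes "lux_norm M p g < ennreal l" "AE x in M. 0 \<le> p x"
  shows "(\<integral>\<^sup>+x. enn_powr (g x / ennreal l) (p x) \<partial>M) \<le> 1"
proof -
  obtain k where k: "0 < k" "k < l" "(\<integral>\<^sup>+x. enn_powr (g x / ennreal k) (p x) \<partial>M) \<le> 1"
    using assms(1) unfolding lux_norm_def Inf_less_iff by (auto simp: ennreal_less_iff)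
  have "g x / ennreal l \<le> g x / ennreal k" for x
    unfolding divide_ennreal_def using k
    by (intro mult_left_mono) (simp_all add: inverse_ennreal)
  then have "(\<integral>\<^sup>+x. enn_powr (g x / ennreal l) (p x) \<partial>M) \<le> (\<integral>\<^sup>+x. enn_powr (g x / ennreal k) (p x) \<partial>M)"
    using assms(2) by (intro nn_integral_mono_AE) (auto intro: enn_powr_mono)
  with k show ?thesis by simp
qed

lemma lux_norm_AE_zero:
  assumes "AE x in M. g x = 0" "AE x in M. 0 \<le> p x"
  shows "lux_norm M p g = 0"
proof -
  have *: "(\<integral>\<^sup>+x. enn_powr (g x / ennreal l) (p x) \<partial>M) = 0" for l
  proof -
    have "(\<integral>\<^sup>+x. enn_powr (g x / ennreal l) (p x) \<partial>M) = (\<integral>\<^sup>+x. 0 \<partial>M)"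
      using assms by (intro nn_integral_cong_AE) auto
    then show ?thesis by simp
  qed
  have "lux_norm M p g \<le> 0 + ennreal e" if "0 < e" for e
    using lux_norm_le[OF that, where g = g and p = p and M = M] * by simp
  then show ?thesis
    by (metis ennreal_le_epsilon le_zero_eq)
qed

text \<open>The modulars of \<open>n g\<close> are at most 1 for all \<open>n\<close>, and they increase to the integral of a
  function that is \<open>\<infinity>\<close> wherever \<open>g \<noteq> 0\<close>.\<close>

lemma AE_zero_if_lux_norm_zero:
  assumes [measurable]: "g \<in> borel_measurable M" "p \<in> borel_measurable M"
    and p: "AE x in M. 0 < p x" and 0: "lux_norm M p g = 0"
  shows "AE x in M. g x = 0"
proof -
  let ?G = "\<lambda>(n::nat) x. enn_powr (g x / ennreal (1 / Suc n)) (p x)"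
  have "(\<integral>\<^sup>+x. (SUP n. ?G n x) \<partial>M) = (SUP n. \<integral>\<^sup>+x. ?G n x \<partial>M)"
  proof (intro nn_integral_monotone_convergence_SUP_AE)
    fix n
    have mono: "g x / ennreal (1 / Suc n) \<le> g x / ennreal (1 / Suc (Suc n))" for x
      unfolding divide_ennreal_def
      by (intro mult_left_mono) (simp_all add: inverse_ennreal)
    show "AE x in M. ?G n x \<le> ?G (Suc n) x"
      using p by eventually_elim (rule enn_powr_mono[OF mono], simp)
  qed measurable
  also have "\<dots> \<le> 1"
    using p by (intro SUP_least modular_le_1_if_lux_norm_less) (auto simp: 0 elim: eventually_mono)
  finally have "(\<integral>\<^sup>+x. (SUP n. ?G n x) \<partial>M) \<noteq> \<infinity>"
    by (auto simp: top_unique)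
  then have "AE x in M. (SUP n. ?G n x) \<noteq> \<infinity>"
    by (intro nn_integral_noteq_infinite) measurable
  with p show ?thesis
  proof eventually_elim
    fix x assume px: "0 < p x" and fin: "(SUP n. ?G n x) \<noteq> \<infinity>"
    show "g x = 0"
    proof (rule ccontr)
      assume "g x \<noteq> 0"
      have "\<exists>n. of_nat N \<le> ?G n x" for N :: nat
      proof (cases "g x")
        case (real a)
        with \<open>g x \<noteq> 0\<close> have a: "0 < a" by auto
        obtain n where n: "real N powr (1 / p x) / a \<le> real n"
          using real_arch_simple by blast
        have "real N = (real N powr (1 / p x)) powr p x"
          using px by (simp add: powr_powr)
        also have "\<dots> \<le> (a * Suc n) powr p x"
          using n a px by (intro powr_mono2) (auto simp: field_simps)
        finally have "ennreal (real N) \<le> ?G n x"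
          using a real by (simp add: divide_ennreal ennreal_leI)
        then show ?thesis by (auto simp: ennreal_of_nat_eq_real_of_nat)
      next
        case top
        then show ?thesis by (simp add: ennreal_top_divide)
      qed
      then have "of_nat N \<le> (SUP n. ?G n x)" for N :: nat
        by (meson SUP_upper2 UNIV_I)
      then show False
        using fin by (metis ennreal_Ex_less_of_nat infinity_ennreal_def leD top.not_eq_extremum)
    qed
  qed
qed

text \<open>Both degenerate products are correct here: for \<open>c = \<infinity>\<close> and \<open>\<parallel>g\<parallel> = 0\<close> the function \<open>c g\<close> still
  vanishes almost everywhere.\<close>

lemma lux_norm_cmult_le:
  assumes [measurable]: "g \<in> borel_measurable M" "p \<in> borel_measurable M"
    and p: "AE x in M. 0 < p x"
  shows "lux_norm M p (\<lambda>x. c * g x) \<le> c * lux_norm M p g"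
proof -
  have p0: "AE x in M. 0 \<le> p x"
    using p by eventually_elim simp
  consider "c = 0" | "lux_norm M p g = 0" | "c = top" "lux_norm M p g \<noteq> 0" | "0 < c" "c < top"
    by (metis not_gr_zero top.not_eq_extremum)
  then show ?thesis
  proof cases
    case 1
    then show ?thesis using lux_norm_AE_zero[OF _ p0] by simp
  next
    case 2
    have "AE x in M. c * g x = 0"
      using AE_zero_if_lux_norm_zero[OF _ _ p 2] by simp
    then show ?thesis using lux_norm_AE_zero[OF _ p0] by simp
  next
    case 3
    then show ?thesis by (simp add: ennreal_top_mult)
  next
    case 4
    then obtain r where r: "c = ennreal r" "0 < r"
      by (cases c) auto
    show ?thesis
      unfolding lux_norm_def[of M p g]
    proof (intro le_cmult_Inf_ennreal, safe)
      fix l :: real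
      assume l: "0 < l" "(\<integral>\<^sup>+x. enn_powr (g x / ennreal l) (p x) \<partial>M) \<le> 1"
      have "c * g x / ennreal (r * l) = g x / ennreal l" for x
        unfolding r using r l
        by (cases "g x") (auto simp: divide_ennreal ennreal_mult_top ennreal_top_divide simp flip: ennreal_mult)
      with l r have "lux_norm M p (\<lambda>x. c * g x) \<le> ennreal (r * l)"
        by (intro lux_norm_le) auto
      then show "lux_norm M p (\<lambda>x. c * g x) \<le> c * ennreal l"
        using l r by (simp add: ennreal_mult)
    qed (use 4 in auto)
  qed
qed

text \<open>This is the preceding inequality for the reverse scaling \<open>g = c\<^sup>-\<^sup>1 (c g)\<close>.\<close>

lemma lux_norm_cmult_ge:
  assumes "g \<in> borel_measurable M" "p \<in> borel_measurable M" "AE x in M. 0 < p x"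
    and "c < top"
  shows "c * lux_norm M p g \<le> lux_norm M p (\<lambda>x. c * g x)"
proof (cases "c = 0")
  case False
  then have inv: "c * inverse c = 1"
    using \<open>c < top\<close> by (simp add: mult_inverse_ennreal zero_less_iff_neq_zero)
  have "lux_norm M p (\<lambda>x. inverse c * (c * g x)) \<le> inverse c * lux_norm M p (\<lambda>x. c * g x)"
    using assms by (intro lux_norm_cmult_le) auto
  then have "lux_norm M p g \<le> inverse c * lux_norm M p (\<lambda>x. c * g x)"
    by (simp add: inv mult.commute[of _ c] flip: mult.assoc)
  then have "c * lux_norm M p g \<le> c * (inverse c * lux_norm M p (\<lambda>x. c * g x))"
    by (intro mult_left_mono) auto
  then show ?thesis
    by (simp add: inv flip: mult.assoc)
qed simp

section \<open>Duality\<close>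

text \<open>If \<open>k\<close> and \<open>l\<close> are admissible for \<open>f\<close> and \<open>g\<close>, then integrating the Young inequality for
  \<open>(f / k) (g / l)\<close> gives \<open>1 + 1\<close>. For variable exponents the factors \<open>1/p(x)\<close> and \<open>1/p'(x)\<close> in that
  inequality cannot be taken out of the integrals, which is why the constant exceeds 1.\<close>

lemma lux_norm_Holder_inequality:
  assumes [measurable]: "f \<in> borel_measurable M" "g \<in> borel_measurable M" "p \<in> borel_measurable M"
    and p: "AE x in M. 1 < p x"
  shows "(\<integral>\<^sup>+x. f x * g x \<partial>M) \<le> 2 * lux_norm M p f * lux_norm M (conj_exp p) g"
proof -
  let ?a = "lux_norm M p f" and ?b = "lux_norm M (conj_exp p) g"
  have [measurable]: "conj_exp p \<in> borel_measurable M"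
    unfolding conj_exp_def by measurable
  have p0: "AE x in M. 0 < p x" and q0: "AE x in M. 0 < conj_exp p x"
    using p by (eventually_elim, simp add: conj_exp_def)+
  have null: "(\<integral>\<^sup>+x. f x * g x \<partial>M) = 0" if "AE x in M. f x * g x = 0"
    using that by (simp add: nn_integral_0_iff_AE)
  consider "?a = 0" | "?b = 0" | "?a \<noteq> 0" "?b \<noteq> 0" by blast
  then show ?thesis
  proof cases
    case 1
    with AE_zero_if_lux_norm_zero[OF _ _ p0 1] show ?thesis
      by (subst null) (auto elim: eventually_mono)
  next
    case 2
    with AE_zero_if_lux_norm_zero[OF _ _ q0 2] show ?thesis
      by (subst null) (auto elim: eventually_mono)
  next
    case 3
    have main: "(\<integral>\<^sup>+x. f x * g x \<partial>M) \<le> 2 * ennreal k * ennreal l"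
      if k: "0 < k" "(\<integral>\<^sup>+x. enn_powr (f x / ennreal k) (p x) \<partial>M) \<le> 1"
        and l: "0 < l" "(\<integral>\<^sup>+x. enn_powr (g x / ennreal l) (conj_exp p x) \<partial>M) \<le> 1" for k l
    proof -
      have "f x * g x = ennreal (k * l) * ((f x / ennreal k) * (g x / ennreal l))" for x
      proof -
        have "f x * g x = (ennreal k * (f x / ennreal k)) * (ennreal l * (g x / ennreal l))"
          using k l by (simp add: mult_divide_cancel_ennreal)
        also have "\<dots> = ennreal (k * l) * ((f x / ennreal k) * (g x / ennreal l))"
          using k l by (simp only: ennreal_mult less_imp_le mult_ac)
        finally show ?thesis .
      qed
      then have "(\<integral>\<^sup>+x. f x * g x \<partial>M)
          = ennreal (k * l) * (\<integral>\<^sup>+x. (f x / ennreal k) * (g x / ennreal l) \<partial>M)"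
        by (simp add: nn_integral_cmult)
      also have "\<dots> \<le> ennreal (k * l) *
          (\<integral>\<^sup>+x. enn_powr (f x / ennreal k) (p x) + enn_powr (g x / ennreal l) (conj_exp p x) \<partial>M)"
        using p unfolding conj_exp_def
        by (intro mult_left_mono nn_integral_mono_AE)
          (auto elim!: eventually_mono intro: enn_powr_Youngs_inequality)
      also have "\<dots> \<le> ennreal (k * l) * (1 + 1)"
        using k l by (intro mult_left_mono) (simp_all add: nn_integral_add add_mono del: one_add_one)
      also have "\<dots> = 2 * ennreal k * ennreal l"
        using k l by (simp add: ennreal_mult mult_ac)
      finally show ?thesis .
    qed
    have half: "(\<integral>\<^sup>+x. f x * g x \<partial>M) \<le> 2 * ennreal k * ?b"
      if k: "0 < k" "(\<integral>\<^sup>+x. enn_powr (f x / ennreal k) (p x) \<partial>M) \<le> 1" for k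
      unfolding lux_norm_def[of M "conj_exp p" g]
    proof (intro le_cmult_Inf_ennreal, safe)
      fix l :: real
      assume l: "0 < l" "(\<integral>\<^sup>+x. enn_powr (g x / ennreal l) (conj_exp p x) \<partial>M) \<le> 1"
      show "(\<integral>\<^sup>+x. f x * g x \<partial>M) \<le> 2 * ennreal k * ennreal l"
        by (rule main[OF k l])
    qed (use k in \<open>auto simp: ennreal_mult_eq_top_iff\<close>)
    show ?thesis
    proof (cases "?b = top")
      case False
      have "(\<integral>\<^sup>+x. f x * g x \<partial>M) \<le> 2 * ?b * ?a"
        unfolding lux_norm_def[of M p f]
      proof (intro le_cmult_Inf_ennreal, safe)
        fix k :: real
        assume k: "0 < k" "(\<integral>\<^sup>+x. enn_powr (f x / ennreal k) (p x) \<partial>M) \<le> 1"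
        show "(\<integral>\<^sup>+x. f x * g x \<partial>M) \<le> 2 * ?b * ennreal k"
          using half[OF k] by (simp add: mult_ac)
      qed (use 3 False in \<open>auto simp: ennreal_mult_eq_top_iff\<close>)
      then show ?thesis by (simp add: mult_ac)
    qed (use 3 in \<open>simp add: ennreal_mult_top\<close>)
  qed
qed

text \<open>The norming function is the classical \<open>(g / l)\<^sup>p\<^sup>'\<^sup>-\<^sup>1\<close>, whose \<open>p\<close>-th power is \<open>G = (g / l)\<^sup>p\<^sup>'\<close>.
  As \<open>l\<close> lies below the norm, \<open>\<integral> G > 1\<close>, possibly infinite; restricting to \<open>G \<le> n\<close> for a large \<open>n\<close>
  makes the integral a finite \<open>R > 1\<close>, at most \<open>n \<mu>(B)\<close>. Division by \<open>R\<close> yields \<open>h\<close>: it brings the modular down to at most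
  \<open>R / R = 1\<close>, because \<open>p \<ge> 1\<close>, and \<open>h g = l G / R\<close> still has integral \<open>l\<close>.\<close>

lemma lux_norm_conj_exp_norming:
  assumes [measurable]: "g \<in> borel_measurable M" "p \<in> borel_measurable M" "B \<in> sets M"
    and p: "AE x in M. 1 < p x" and B: "emeasure M B < \<infinity>"
    and supp: "\<And>x. x \<notin> B \<Longrightarrow> g x = 0" and fin: "AE x in M. g x < \<infinity>"
    and l: "0 < l" "ennreal l < lux_norm M (conj_exp p) g"
  obtains h :: "'a \<Rightarrow> real"
  where "h \<in> borel_measurable M" "\<And>x. 0 \<le> h x" "\<And>x. x \<notin> B \<Longrightarrow> h x = 0"
    and "lux_norm M p (\<lambda>x. ennreal (h x)) \<le> 1"
    and "ennreal l \<le> (\<integral>\<^sup>+x. ennreal (h x) * g x \<partial>M)"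
proof -
  have [measurable]: "conj_exp p \<in> borel_measurable M"
    unfolding conj_exp_def by measurable
  define G where "G = (\<lambda>x. enn_powr (g x / ennreal l) (conj_exp p x))"
  have [measurable]: "G \<in> borel_measurable M"
    unfolding G_def by measurable
  have g_top: "g x < top" if "G x < top" for x
    using that l(1) by (cases "g x") (auto simp: G_def ennreal_top_divide)
  define T where "T n = {x. G x \<le> of_nat n}" for n :: nat
  have T_sets [measurable]: "Measurable.pred M (\<lambda>x. x \<in> T n)" for n
    unfolding T_def by simp
  have "1 < (\<integral>\<^sup>+x. G x \<partial>M)"
    using lux_norm_le[OF l(1), where g = g and p = "conj_exp p" and M = M] l(2) by (force simp: G_def)
  also have "(\<integral>\<^sup>+x. G x \<partial>M) = (\<integral>\<^sup>+x. (SUP n. G x * indicator (T n) x) \<partial>M)"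
  proof (intro nn_integral_cong_AE)
    show "AE x in M. G x = (SUP n. G x * indicator (T n) x)"
      using fin
    proof eventually_elim
      fix x assume "g x < \<infinity>"
      then have "G x < top"
        using l(1) by (cases "g x") (auto simp: G_def divide_ennreal)
      then obtain n where "G x < of_nat n"
        using ennreal_Ex_less_of_nat by auto
      then have "G x \<le> G x * indicator (T n) x"
        by (simp add: T_def)
      then show "G x = (SUP n. G x * indicator (T n) x)"
        by (intro antisym SUP_least) (auto intro: SUP_upper2 simp: indicator_def)
    qed
  qed
  also have "\<dots> = (SUP n. \<integral>\<^sup>+x. G x * indicator (T n) x \<partial>M)"
  proof (intro nn_integral_monotone_convergence_SUP)
    show "incseq (\<lambda>n x. G x * indicator (T n) x)"
      by (auto simp: incseq_def le_fun_def T_def indicator_def intro: order_trans)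
  qed measurable
  finally obtain n where n: "1 < (\<integral>\<^sup>+x. G x * indicator (T n) x \<partial>M)"
    by (auto simp: less_SUP_iff)
  have "(\<integral>\<^sup>+x. G x * indicator (T n) x \<partial>M) \<le> (\<integral>\<^sup>+x. of_nat n * indicator B x \<partial>M)"
    using supp by (intro nn_integral_mono) (auto simp: indicator_def T_def G_def)
  also have "\<dots> < top"
    using B by (simp add: nn_integral_cmult_indicator ennreal_mult_less_top of_nat_less_top)
  finally obtain R where R: "(\<integral>\<^sup>+x. G x * indicator (T n) x \<partial>M) = ennreal R" "1 < R"
    using n by (cases "\<integral>\<^sup>+x. G x * indicator (T n) x \<partial>M") auto
  define u where "u x = enn2real (g x / ennreal l)" for x
  define h where "h x = u x powr (conj_exp p x - 1) / R * indicator (T n) x" for x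
  have u: "0 \<le> u x" for x
    by (simp add: u_def)
  have gu: "g x / ennreal l = ennreal (u x)" "g x = ennreal (l * u x)" "G x = ennreal (u x powr conj_exp p x)"
    if "x \<in> T n" for x
  proof -
    have "G x < top"
      using that by (auto simp: T_def intro: le_less_trans of_nat_less_top)
    then obtain a where a: "g x = ennreal a" "0 \<le> a"
      using g_top[of x] by (cases "g x") auto
    then show "g x / ennreal l = ennreal (u x)" "g x = ennreal (l * u x)"
      using l(1) by (auto simp: u_def divide_ennreal)
    then show "G x = ennreal (u x powr conj_exp p x)"
      using u by (simp add: G_def)
  qed
  show thesis
  proof
    show "h \<in> borel_measurable M"
      unfolding h_def u_def by measurable
    show "0 \<le> h x" for x
      using R by (simp add: h_def)
    show "h x = 0" if "x \<notin> B" for x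
      using supp[OF that] by (simp add: h_def u_def)
    have "(\<integral>\<^sup>+x. enn_powr (ennreal (h x) / ennreal 1) (p x) \<partial>M)
        \<le> (\<integral>\<^sup>+x. ennreal (1 / R) * (G x * indicator (T n) x) \<partial>M)"
    proof (intro nn_integral_mono_AE)
      show "AE x in M. enn_powr (ennreal (h x) / ennreal 1) (p x)
          \<le> ennreal (1 / R) * (G x * indicator (T n) x)"
        using p
      proof eventually_elim
        fix x assume px: "1 < p x"
        show "enn_powr (ennreal (h x) / ennreal 1) (p x) \<le> ennreal (1 / R) * (G x * indicator (T n) x)"
        proof (cases "x \<in> T n")
          case True
          have "(conj_exp p x - 1) * p x = conj_exp p x"
            using px by (simp add: conj_exp_def field_simps)
          then have "h x powr p x = u x powr conj_exp p x / R powr p x"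
            using True R by (simp add: h_def powr_divide powr_powr)
          also have "\<dots> \<le> u x powr conj_exp p x / R"
            using R px powr_mono[of 1 "p x" R] by (intro divide_left_mono) auto
          finally show ?thesis
            using True R \<open>0 \<le> h x\<close> by (simp add: gu divide_ennreal_def ennreal_leI flip: ennreal_mult)
        qed (simp add: h_def)
      qed
    qed
    also have "\<dots> = ennreal (1 / R) * ennreal R"
      by (simp add: nn_integral_cmult R)
    also have "\<dots> = 1"
      using R by (simp flip: ennreal_mult)
    finally have "lux_norm M p (\<lambda>x. ennreal (h x)) \<le> ennreal 1"
      by (intro lux_norm_le) auto
    then show "lux_norm M p (\<lambda>x. ennreal (h x)) \<le> 1"
      by simp
    have "ennreal l = ennreal (l / R) * ennreal R"
      using R l by (simp flip: ennreal_mult)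
    also have "\<dots> = (\<integral>\<^sup>+x. ennreal (l / R) * (G x * indicator (T n) x) \<partial>M)"
      by (simp add: nn_integral_cmult R)
    also have "\<dots> = (\<integral>\<^sup>+x. ennreal (h x) * g x \<partial>M)"
    proof (intro nn_integral_cong)
      fix x
      show "ennreal (l / R) * (G x * indicator (T n) x) = ennreal (h x) * g x"
      proof (cases "x \<in> T n")
        case True
        have "u x powr conj_exp p x = u x powr (conj_exp p x - 1) * u x"
          using u[of x] by (cases "u x = 0") (auto simp: powr_diff)
        then show ?thesis
          using True R l u[of x] by (simp add: gu h_def mult_ac flip: ennreal_mult)
      qed (simp add: h_def)
    qed
    finally show "ennreal l \<le> (\<integral>\<^sup>+x. ennreal (h x) * g x \<partial>M)"
      by simp
  qed
qed

section \<open>Averages of weighted functions\<close>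

lemma set_nn_integral_le_wnorm:
  assumes [measurable]: "f \<in> borel_measurable M" "v \<in> borel_measurable M" "p \<in> borel_measurable M" "B \<in> sets M"
    and p: "AE x in M. 1 < p x" and v: "AE x in M. 0 < v x \<and> v x < \<infinity>"
  shows "(\<integral>\<^sup>+x\<in>B. f x \<partial>M)
    \<le> 2 * wnorm M p v f * lux_norm M (conj_exp p) (\<lambda>x. inverse (v x) * indicator B x)"
proof -
  have "(\<integral>\<^sup>+x\<in>B. f x \<partial>M) = (\<integral>\<^sup>+x. (v x * f x) * (inverse (v x) * indicator B x) \<partial>M)"
  proof (intro nn_integral_cong_AE)
    show "AE x in M. f x * indicator B x = (v x * f x) * (inverse (v x) * indicator B x)"
      using v
    proof eventually_elim
      fix x assume "0 < v x \<and> v x < \<infinity>"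
      then have "v x * inverse (v x) = 1"
        by (simp add: mult_inverse_ennreal)
      then have "(v x * inverse (v x)) * (f x * indicator B x) = f x * indicator B x"
        by simp
      then show "f x * indicator B x = (v x * f x) * (inverse (v x) * indicator B x)"
        by (simp only: mult_ac)
    qed
  qed
  also have "\<dots> \<le> 2 * wnorm M p v f * lux_norm M (conj_exp p) (\<lambda>x. inverse (v x) * indicator B x)"
    unfolding wnorm_def using p by (intro lux_norm_Holder_inequality) auto
  finally show ?thesis .
qed

text \<open>The norming function \<open>h\<close> of \<open>\<omega>\<^sup>-\<^sup>1 \<chi>\<^sub>B\<close> belongs to the unweighted space; \<open>f = h \<omega>\<^sup>-\<^sup>1\<close> transfers it to
  the weighted one.\<close>

lemma ex_wLp_norming:
  assumes [measurable]: "v \<in> borel_measurable M" "p \<in> borel_measurable M" "B \<in> sets M"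
    and p: "AE x in M. 1 < p x" and v: "AE x in M. 0 < v x \<and> v x < \<infinity>"
    and B: "emeasure M B < \<infinity>"
    and l: "0 < l" "l < lux_norm M (conj_exp p) (\<lambda>x. inverse (v x) * indicator B x)"
  shows "\<exists>f\<in>wLp M p v. wnorm M p v (\<lambda>x. ennreal \<bar>f x\<bar>) \<le> 1 \<and> l \<le> (\<integral>\<^sup>+x\<in>B. ennreal \<bar>f x\<bar> \<partial>M)"
proof -
  let ?g = "\<lambda>x. inverse (v x) * indicator B x :: ennreal"
  obtain r where r: "l = ennreal r" "0 < r"
    using l by (cases l) auto
  have inv: "v x * inverse (v x) = 1" "inverse (v x) < top" if "0 < v x \<and> v x < \<infinity>" for x
    using that by (auto simp: mult_inverse_ennreal less_top[symmetric] ennreal_inverse_eq_top_iff zero_less_iff_neq_zero)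
  have fin: "AE x in M. ?g x < \<infinity>"
    using v by eventually_elim (use inv(2) in \<open>auto simp: indicator_def\<close>)
  obtain h :: "'a \<Rightarrow> real" where h [measurable]: "h \<in> borel_measurable M"
    and h0: "\<And>x. 0 \<le> h x" "\<And>x. x \<notin> B \<Longrightarrow> h x = 0"
    and h1: "lux_norm M p (\<lambda>x. ennreal (h x)) \<le> 1"
    and h2: "ennreal r \<le> (\<integral>\<^sup>+x. ennreal (h x) * ?g x \<partial>M)"
    using lux_norm_conj_exp_norming[of ?g M p B r] p B fin l r
    by (auto simp: indicator_def)
  define f where "f x = enn2real (ennreal (h x) * ?g x)" for x
  have [measurable]: "f \<in> borel_measurable M"
    unfolding f_def by measurable
  have f: "AE x in M. ennreal \<bar>f x\<bar> = ennreal (h x) * ?g x"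
    using fin by eventually_elim (auto simp: f_def ennreal_mult_less_top)
  have "wnorm M p v (\<lambda>x. ennreal \<bar>f x\<bar>) \<le> lux_norm M p (\<lambda>x. ennreal (h x))"
    unfolding wnorm_def
  proof (rule lux_norm_mono)
    show "AE x in M. v x * ennreal \<bar>f x\<bar> \<le> ennreal (h x)"
      using f v
    proof eventually_elim
      fix x assume fx: "ennreal \<bar>f x\<bar> = ennreal (h x) * ?g x" and vx: "0 < v x \<and> v x < \<infinity>"
      have "v x * ennreal \<bar>f x\<bar> = (v x * inverse (v x)) * (ennreal (h x) * indicator B x)"
        unfolding fx by (simp only: mult_ac)
      then show "v x * ennreal \<bar>f x\<bar> \<le> ennreal (h x)"
        using inv(1)[OF vx] by (simp add: indicator_def)
    qed
    show "AE x in M. 0 \<le> p x"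
      using p by eventually_elim simp
  qed
  also note h1
  finally have 1: "wnorm M p v (\<lambda>x. ennreal \<bar>f x\<bar>) \<le> 1" .
  have "(\<integral>\<^sup>+x. ennreal (h x) * ?g x \<partial>M) = (\<integral>\<^sup>+x\<in>B. ennreal \<bar>f x\<bar> \<partial>M)"
    using f by (intro nn_integral_cong_AE, eventually_elim) (auto simp: indicator_def)
  with h2 r have 2: "l \<le> (\<integral>\<^sup>+x\<in>B. ennreal \<bar>f x\<bar> \<partial>M)"
    by simp
  have "f \<in> wLp M p v"
    using 1 by (auto simp: wLp_def intro: le_less_trans)
  with 1 2 show ?thesis by blast
qed

section \<open>Averaging operators on a single ball\<close>

definition A_term ::
  "'a measure \<Rightarrow> nat \<Rightarrow> real \<Rightarrow> (nat \<Rightarrow> 'a \<Rightarrow> real) \<Rightarrow> ('a \<Rightarrow> real) \<Rightarrow>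
   (nat \<Rightarrow> 'a \<Rightarrow> ennreal) \<Rightarrow> ('a \<Rightarrow> ennreal) \<Rightarrow> 'a set \<Rightarrow> ennreal" where
  "A_term M m \<eta> ps q ws w B =
     enn_powr (emeasure M B) (\<eta> - real m) *
     lux_norm M q (\<lambda>x. w x * indicator B x) *
     (\<Prod>i=1..m. lux_norm M (conj_exp (ps i)) (\<lambda>x. inverse (ws i x) * indicator B x))"

lemma A_const_eq_SUP_A_term: "A_const d M m \<eta> ps q ws w = (SUP B\<in>qballs d. A_term M m \<eta> ps q ws w B)"
  by (simp add: A_const_def A_term_def)

lemma avg_op_bound_mono:
  "avg_op_bound M m \<eta> ps q ws w B K \<Longrightarrow> K \<le> K' \<Longrightarrow> avg_op_bound M m \<eta> ps q ws w B K'"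
  unfolding avg_op_bound_def by (meson mult_right_mono order_trans zero_le)

text \<open>The \<open>m\<close> averages contribute \<open>\<mu>(B)\<^sup>-\<^sup>m\<close>, which together with \<open>\<mu>(B)\<^sup>\<eta>\<close> is the power of the measure that
  occurs in the weight constant.\<close>

lemma avg_op_eq:
  assumes "0 < emeasure M B" "emeasure M B < \<infinity>"
  shows "avg_op M m \<eta> B fs = (\<lambda>x.
    enn_powr (emeasure M B) (\<eta> - real m) * (\<Prod>i=1..m. \<integral>\<^sup>+y\<in>B. ennreal \<bar>fs i y\<bar> \<partial>M) * indicator B x)"
proof -
  obtain r where r: "emeasure M B = ennreal r" "0 < r"
    using assms by (cases "emeasure M B") auto
  have "enn_powr (emeasure M B) \<eta> * inverse (emeasure M B) ^ m = ennreal (r powr \<eta> * (1 / r) ^ m)"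
    using r by (simp add: inverse_ennreal ennreal_power ennreal_mult divide_inverse)
  also have "r powr \<eta> * (1 / r) ^ m = r powr (\<eta> - real m)"
    using r by (simp add: powr_diff powr_realpow field_simps)
  also have "ennreal \<dots> = enn_powr (emeasure M B) (\<eta> - real m)"
    using r by simp
  finally have "enn_powr (emeasure M B) \<eta> * inverse (emeasure M B) ^ m = enn_powr (emeasure M B) (\<eta> - real m)" .
  then show ?thesis
    unfolding avg_op_def divide_ennreal_def
    by (simp add: prod.distrib mult_ac flip: mult.assoc[of "enn_powr (emeasure M B) \<eta>" "inverse (emeasure M B) ^ m"])
qed

lemma cmult_le_if_cmult_less_le:
  fixes c K N :: ennreal
  assumes "\<And>l. 0 < l \<Longrightarrow> l < N \<Longrightarrow> c * l \<le> K"
  shows "c * N \<le> K"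
proof (cases "N = 0")
  case False
  have "c * l \<le> K" if "l < N" for l
    using assms[OF _ that] by (cases "l = 0") (auto simp: zero_less_iff_neq_zero)
  moreover have "c * N = (SUP l\<in>{..<N}. c * l)"
    using False by (simp add: SUP_mult_left_ennreal[symmetric])
  ultimately show ?thesis
    by (simp add: SUP_le_iff)
qed simp

text \<open>The norms \<open>N i\<close> need not be attained by test functions, so the lower estimate is obtained for all
  \<open>l i < N i\<close> only. The factors are raised to \<open>N i\<close> one at a time.\<close>

lemma cmult_prod_le_if_cmult_prod_less_le:
  fixes c K :: ennreal and N :: "'i \<Rightarrow> ennreal"
  assumes "finite I" "\<And>l. (\<And>i. i \<in> I \<Longrightarrow> 0 < l i \<and> l i < N i) \<Longrightarrow> c * (\<Prod>i\<in>I. l i) \<le> K"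
  shows "c * (\<Prod>i\<in>I. N i) \<le> K"
  using assms
proof (induction I arbitrary: c)
  case (insert j I)
  have "(c * (\<Prod>i\<in>I. N i)) * N j \<le> K"
  proof (rule cmult_le_if_cmult_less_le)
    fix a assume a: "0 < a" "a < N j"
    have "(c * a) * (\<Prod>i\<in>I. N i) \<le> K"
    proof (rule insert.IH)
      fix l assume l: "\<And>i. i \<in> I \<Longrightarrow> 0 < l i \<and> l i < N i"
      have "c * (\<Prod>i\<in>insert j I. (l(j := a)) i) \<le> K"
        using l a by (intro insert.prems) auto
      also have "(\<Prod>i\<in>insert j I. (l(j := a)) i) = a * (\<Prod>i\<in>I. l i)"
        using insert.hyps by (subst prod.insert) (auto intro!: arg_cong[where f = "(*) a"] prod.cong)
      finally show "(c * a) * (\<Prod>i\<in>I. l i) \<le> K"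
        by (simp add: mult_ac)
    qed
    then show "(c * (\<Prod>i\<in>I. N i)) * a \<le> K"
      by (simp add: mult_ac)
  qed
  then show ?case
    using insert.hyps by (simp add: mult_ac)
qed simp

context
  fixes M :: "'a measure" and m :: nat and \<eta> :: real and ps :: "nat \<Rightarrow> 'a \<Rightarrow> real"
    and q :: "'a \<Rightarrow> real" and ws :: "nat \<Rightarrow> 'a \<Rightarrow> ennreal" and w :: "'a \<Rightarrow> ennreal" and B :: "'a set"
  assumes B: "B \<in> sets M" "0 < emeasure M B" "emeasure M B < \<infinity>"
    and q: "q \<in> borel_measurable M" "AE x in M. 0 < q x"
    and w: "w \<in> borel_measurable M"
    and ps: "\<And>i. i \<in> {1..m} \<Longrightarrow> ps i \<in> borel_measurable M" "\<And>i. i \<in> {1..m} \<Longrightarrow> AE x in M. 1 < ps i x"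
    and ws: "\<And>i. i \<in> {1..m} \<Longrightarrow> ws i \<in> borel_measurable M"
      "\<And>i. i \<in> {1..m} \<Longrightarrow> AE x in M. 0 < ws i x \<and> ws i x < \<infinity>"
begin

lemma A_term_le_if_avg_op_bound:
  assumes K: "avg_op_bound M m \<eta> ps q ws w B K"
  shows "A_term M m \<eta> ps q ws w B \<le> K"
  unfolding A_term_def
proof (rule cmult_prod_le_if_cmult_prod_less_le)
  let ?a = "enn_powr (emeasure M B) (\<eta> - real m)"
  let ?W = "\<lambda>x. w x * indicator B x"
  have W: "?W \<in> borel_measurable M"
    using w B(1) by measurable
  fix l :: "nat \<Rightarrow> ennreal"
  assume l: "\<And>i. i \<in> {1..m} \<Longrightarrow>
    0 < l i \<and> l i < lux_norm M (conj_exp (ps i)) (\<lambda>x. inverse (ws i x) * indicator B x)"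
  have "\<exists>f\<in>wLp M (ps i) (ws i). wnorm M (ps i) (ws i) (\<lambda>x. ennreal \<bar>f x\<bar>) \<le> 1
      \<and> l i \<le> (\<integral>\<^sup>+x\<in>B. ennreal \<bar>f x\<bar> \<partial>M)" if "i \<in> {1..m}" for i
    using l[OF that] ws[OF that] ps[OF that] B by (intro ex_wLp_norming) auto
  then obtain fs where fs: "\<And>i. i \<in> {1..m} \<Longrightarrow> fs i \<in> wLp M (ps i) (ws i)"
      "\<And>i. i \<in> {1..m} \<Longrightarrow> wnorm M (ps i) (ws i) (\<lambda>x. ennreal \<bar>fs i x\<bar>) \<le> 1"
      "\<And>i. i \<in> {1..m} \<Longrightarrow> l i \<le> (\<integral>\<^sup>+x\<in>B. ennreal \<bar>fs i x\<bar> \<partial>M)"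
    by metis
  \<comment> \<open>The integrals of the test functions may be infinite, and \<^emph>\<open>lux_norm_cmult_ge\<close> needs a finite
    scalar; hence they are replaced by the numbers \<open>l i\<close>.\<close>
  have "?a < top"
    using B by (cases "emeasure M B") auto
  moreover have "(\<Prod>i=1..m. l i) < top"
    using l by (force simp: less_top[symmetric] ennreal_prod_eq_top)
  ultimately have fin: "?a * (\<Prod>i=1..m. l i) < top"
    by (simp add: ennreal_mult_less_top)
  have "?a * lux_norm M q ?W * (\<Prod>i=1..m. l i) = ?a * (\<Prod>i=1..m. l i) * lux_norm M q ?W"
    by (simp add: mult_ac)
  also have "\<dots> \<le> lux_norm M q (\<lambda>x. ?a * (\<Prod>i=1..m. l i) * ?W x)"
    using W q fin by (intro lux_norm_cmult_ge) auto
  also have "\<dots> \<le> wnorm M q w (avg_op M m \<eta> B fs)"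
    unfolding avg_op_eq[OF B(2,3)] wnorm_def
  proof (rule lux_norm_mono)
    have "?a * (\<Prod>i=1..m. l i) * ?W x \<le> ?a * (\<Prod>i=1..m. \<integral>\<^sup>+y\<in>B. ennreal \<bar>fs i y\<bar> \<partial>M) * ?W x" for x
      using fs(3) by (intro mult_right_mono mult_left_mono prod_mono_ennreal) auto
    then show "AE x in M. ?a * (\<Prod>i=1..m. l i) * ?W x
        \<le> w x * (?a * (\<Prod>i=1..m. \<integral>\<^sup>+y\<in>B. ennreal \<bar>fs i y\<bar> \<partial>M) * indicator B x)"
      by (intro always_eventually allI) (simp only: mult_ac)
    show "AE x in M. 0 \<le> q x"
      using q(2) by eventually_elim simp
  qed
  also have "\<dots> \<le> K * (\<Prod>i=1..m. wnorm M (ps i) (ws i) (\<lambda>x. ennreal \<bar>fs i x\<bar>))"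
    using K fs(1) by (simp add: avg_op_bound_def)
  also have "\<dots> \<le> K * (\<Prod>i=1..m. 1)"
    using fs(2) by (intro mult_left_mono prod_mono_ennreal) auto
  finally show "?a * lux_norm M q ?W * (\<Prod>i=1..m. l i) \<le> K"
    by simp
qed simp

lemma avg_op_bound_A_term:
  "avg_op_bound M m \<eta> ps q ws w B (2 ^ m * A_term M m \<eta> ps q ws w B)"
  unfolding avg_op_bound_def
proof (intro allI impI)
  fix fs assume fs: "\<forall>i\<in>{1..m}. fs i \<in> wLp M (ps i) (ws i)"
  let ?a = "enn_powr (emeasure M B) (\<eta> - real m)"
  let ?W = "\<lambda>x. w x * indicator B x"
  let ?I = "\<Prod>i=1..m. \<integral>\<^sup>+y\<in>B. ennreal \<bar>fs i y\<bar> \<partial>M"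
  let ?n = "\<lambda>i. wnorm M (ps i) (ws i) (\<lambda>x. ennreal \<bar>fs i x\<bar>)"
  let ?N = "\<lambda>i. lux_norm M (conj_exp (ps i)) (\<lambda>x. inverse (ws i x) * indicator B x)"
  have W: "?W \<in> borel_measurable M"
    using w B(1) by measurable
  have "wnorm M q w (avg_op M m \<eta> B fs) = lux_norm M q (\<lambda>x. (?a * ?I) * ?W x)"
    unfolding avg_op_eq[OF B(2,3)] wnorm_def by (simp only: mult_ac)
  also have "\<dots> \<le> (?a * ?I) * lux_norm M q ?W"
    using W q by (rule lux_norm_cmult_le)
  also have "?I \<le> (\<Prod>i=1..m. 2 * ?n i * ?N i)"
  proof (intro prod_mono_ennreal)
    fix i assume i: "i \<in> {1..m}"
    with fs have [measurable]: "fs i \<in> borel_measurable M"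
      by (auto simp: wLp_def)
    have "(\<lambda>x. ennreal \<bar>fs i x\<bar>) \<in> borel_measurable M"
      by measurable
    with i show "(\<integral>\<^sup>+y\<in>B. ennreal \<bar>fs i y\<bar> \<partial>M) \<le> 2 * ?n i * ?N i"
      using ps ws B by (intro set_nn_integral_le_wnorm) auto
  qed
  also have "(\<Prod>i=1..m. 2 * ?n i * ?N i) = 2 ^ m * (\<Prod>i=1..m. ?n i) * (\<Prod>i=1..m. ?N i)"
    by (simp add: prod.distrib)
  finally show "wnorm M q w (avg_op M m \<eta> B fs)
      \<le> 2 ^ m * A_term M m \<eta> ps q ws w B * (\<Prod>i=1..m. ?n i)"
    unfolding A_term_def by (simp add: mult_ac mult_left_mono mult_right_mono)
qed

end

section \<open>The characterization of uniform boundedness\<close>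

lemma exponents_AE_gt_1:
  assumes "p \<in> exponents M"
  shows "AE x in M. 1 < p x"
proof -
  have "AE x in M. - ereal (p x) \<le> esssup M (\<lambda>x. - ereal (p x))"
    by (rule esssup_AE)
  then show ?thesis
  proof eventually_elim
    fix x assume x: "- ereal (p x) \<le> esssup M (\<lambda>x. - ereal (p x))"
    have "1 < - esssup M (\<lambda>x. - ereal (p x))"
      using assms by (simp add: exponents_def exp_minus_def)
    also have "\<dots> \<le> ereal (p x)"
      using x ereal_uminus_le_reorder by blast
    finally show "1 < p x" by simp
  qed
qed

lemma homogeneous_type_qball:
  assumes "homogeneous_type d M" "B \<in> qballs d"
  shows "B \<in> sets M" "0 < emeasure M B" "emeasure M B < \<infinity>"
proof -
  show "B \<in> sets M"
    using assms by (auto simp: homogeneous_type_def)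
  obtain x r where B: "B = qball d x r" "0 < r"
    using assms(2) by (auto simp: qballs_def)
  \<comment> \<open>Doubling asserts positivity for balls of radius \<open>2 r\<close>.\<close>
  have "0 < emeasure M (qball d x (2 * (r / 2)))" "emeasure M (qball d x r) < \<infinity>"
    using assms(1) B(2) unfolding homogeneous_type_def doubling_def by (meson half_gt_zero)+
  with B show "0 < emeasure M B" "emeasure M B < \<infinity>"
    by auto
qed

theorem theorem1p12:
  fixes m :: nat and ps :: "nat \<Rightarrow> 'a \<Rightarrow> real"
  assumes "1 \<le> m"
  shows "\<exists>C::real. 0 < C \<and>
    (\<forall>(d :: 'a \<Rightarrow> 'a \<Rightarrow> real) (M :: 'a measure) (p :: 'a \<Rightarrow> real) (q :: 'a \<Rightarrow> real) (\<eta> :: real)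
      (ws :: nat \<Rightarrow> 'a \<Rightarrow> ennreal) (w :: 'a \<Rightarrow> ennreal).
      homogeneous_type d M \<longrightarrow>
      (\<forall>i\<in>{1..m}. ps i \<in> exponents M) \<longrightarrow>
      (\<forall>x. 1 / p x = (\<Sum>i=1..m. 1 / ps i x)) \<longrightarrow>
      q \<in> exponents0 M \<longrightarrow>
      0 \<le> \<eta> \<longrightarrow> \<eta> < real m \<longrightarrow>
      (\<forall>x. 1 / p x - 1 / q x = \<eta>) \<longrightarrow>
      multiple_weight d M m ws w \<longrightarrow>
      (unif_bounded d M m \<eta> ps q ws w \<longleftrightarrow> (ws, w) \<in> A_class d M m \<eta> ps q) \<and>
      A_const d M m \<eta> ps q ws w
        \<le> ennreal C * (SUP B\<in>qballs d. avg_op_norm M m \<eta> ps q ws w B) \<and>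
      (SUP B\<in>qballs d. avg_op_norm M m \<eta> ps q ws w B)
        \<le> ennreal C * A_const d M m \<eta> ps q ws w)"
proof (intro exI[of _ "2 ^ m :: real"] conjI allI impI)
  show "0 < (2 ^ m :: real)" by simp
next
  fix d :: "'a \<Rightarrow> 'a \<Rightarrow> real" and M :: "'a measure" and p q :: "'a \<Rightarrow> real" and \<eta> :: real
    and ws :: "nat \<Rightarrow> 'a \<Rightarrow> ennreal" and w :: "'a \<Rightarrow> ennreal"
  assume hom: "homogeneous_type d M" and ps: "\<forall>i\<in>{1..m}. ps i \<in> exponents M"
    and q: "q \<in> exponents0 M" and mw: "multiple_weight d M m ws w"
  let ?A = "A_const d M m \<eta> ps q ws w"
  let ?S = "SUP B\<in>qballs d. avg_op_norm M m \<eta> ps q ws w B"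
  have q': "q \<in> borel_measurable M" "AE x in M. 0 < q x" and w: "w \<in> borel_measurable M"
    using q mw by (auto simp: exponents0_def multiple_weight_def weight_def)
  have ps': "ps i \<in> borel_measurable M" "AE x in M. 1 < ps i x"
    and ws: "ws i \<in> borel_measurable M" "AE x in M. 0 < ws i x \<and> ws i x < \<infinity>"
    if "i \<in> {1..m}" for i
    using ps mw that exponents_AE_gt_1[of "ps i" M]
    by (auto simp: exponents_def multiple_weight_def weight_def)
  have lower: "A_term M m \<eta> ps q ws w B \<le> K"
    if "B \<in> qballs d" "avg_op_bound M m \<eta> ps q ws w B K" for B K
    using homogeneous_type_qball[OF hom that(1)] q' w ps' ws that(2)
    by (rule A_term_le_if_avg_op_bound)
  have two: "ennreal (2 ^ m) = 2 ^ m"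
    by (simp flip: ennreal_power)
  have upper: "avg_op_bound M m \<eta> ps q ws w B (ennreal (2 ^ m) * ?A)" if "B \<in> qballs d" for B
  proof (rule avg_op_bound_mono)
    show "avg_op_bound M m \<eta> ps q ws w B (2 ^ m * A_term M m \<eta> ps q ws w B)"
      using homogeneous_type_qball[OF hom that(1)] q' w ps' ws
      by (rule avg_op_bound_A_term)
    show "2 ^ m * A_term M m \<eta> ps q ws w B \<le> ennreal (2 ^ m) * ?A"
      unfolding two A_const_eq_SUP_A_term using that by (intro mult_left_mono SUP_upper) auto
  qed
  show "unif_bounded d M m \<eta> ps q ws w \<longleftrightarrow> (ws, w) \<in> A_class d M m \<eta> ps q"
  proof
    assume "unif_bounded d M m \<eta> ps q ws w"
    then obtain K where "\<forall>B\<in>qballs d. avg_op_bound M m \<eta> ps q ws w B (ennreal K)"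
      unfolding unif_bounded_def by blast
    with lower have "?A \<le> ennreal K"
      unfolding A_const_eq_SUP_A_term by (intro SUP_least) auto
    then have "?A < \<infinity>"
      by (rule le_less_trans) simp
    with mw show "(ws, w) \<in> A_class d M m \<eta> ps q"
      by (simp add: A_class_def)
  next
    assume "(ws, w) \<in> A_class d M m \<eta> ps q"
    then have "ennreal (2 ^ m) * ?A < top"
      by (simp add: A_class_def ennreal_mult_less_top)
    then have "ennreal (enn2real (ennreal (2 ^ m) * ?A)) = ennreal (2 ^ m) * ?A"
      by simp
    with upper show "unif_bounded d M m \<eta> ps q ws w"
      unfolding unif_bounded_def by metis
  qed
  have "?A \<le> ?S"
    unfolding A_const_eq_SUP_A_term avg_op_norm_def
    using lower by (intro SUP_mono) (blast intro: Inf_greatest)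
  also have "\<dots> = 1 * ?S"
    by simp
  also have "\<dots> \<le> ennreal (2 ^ m) * ?S"
    by (intro mult_right_mono) (simp_all add: two)
  finally show "?A \<le> ennreal (2 ^ m) * ?S" .
  show "?S \<le> ennreal (2 ^ m) * ?A"
    unfolding avg_op_norm_def using upper by (intro SUP_least Inf_lower) auto
qed

end
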